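(* Let $N\geq1$ be an integer, $m>1$, $0<p<1$, $\sigma=\frac{2(1-p)}{m-1}$, and assume $m+p<2$. Then there exists no good profile with interface (for any self-similar exponent $\alpha>0$).
   Context: The profiles arise from radially symmetric self-similar solutions $u(x,t)=e^{\alpha t}f(\xi)$, $\xi=|x|e^{-\beta t}$, of $u_t=\Delta u^m+|x|^{\sigma}u^p$ in $\mathbb{R}^N$. The self-similar exponents satisfy $\alpha>0$ and $\beta=\frac{m-1}{2}\alpha$, and the profile $f\geq0$ solves $$(f^m)''(\xi)+\frac{N-1}{\xi}(f^m)'(\xi)-\alpha f(\xi)+\beta\xi f'(\xi)+\xi^{\sigma}f(\xi)^p=0.\qquad(\ast)$$ For given $\alpha>0$, a solution $f$ of $(\ast)$ is called a good profile with interface if: (i) $f(0)=A>0$ and $f'(0)=0$; (ii) there exists $\xi_0\in(0,\infty)$ such that $f(\xi_0)=0$, $f(\xi)>0$ for all $\xi\in(0,\xi_0)$, and $(f^m)'(\xi_0)=0$. *)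

theory Defs
  imports "HOL-Analysis.Analysis"
begin

text \<open>
  The profile equation for self-similar solutions $u(x,t) = e^{\alpha t} f(|x| e^{-\beta t})$ of
  $u_t = \Delta u^m + |x|^\sigma u^p$ in dimension $N$. Since \<open>deriv\<close> is a total operator, the
  required differentiability is stated separately.
\<close>

definition solves_profile_eq_on ::
    "nat \<Rightarrow> real \<Rightarrow> real \<Rightarrow> real \<Rightarrow> real \<Rightarrow> real \<Rightarrow> real set \<Rightarrow> (real \<Rightarrow> real) \<Rightarrow> bool"
where
  "solves_profile_eq_on N m p \<sigma> \<alpha> \<beta> S f \<longleftrightarrow>
    (let g = (\<lambda>\<xi>. f \<xi> powr m) in
      \<forall>\<xi>\<in>S. f differentiable (at \<xi>) \<and> g differentiable (at \<xi>) \<and> deriv g differentiable (at \<xi>) \<and>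
        deriv (deriv g) \<xi> + (real N - 1) / \<xi> * deriv g \<xi> - \<alpha> * f \<xi> + \<beta> * \<xi> * deriv f \<xi>
          + \<xi> powr \<sigma> * f \<xi> powr p = 0)"

text \<open>
  The equation degenerates where $f$ vanishes, so it is imposed classically on the positivity
  interval $(0,\xi_0)$ only, and nothing but nonnegativity is asked of $f$ beyond $\xi_0$.
  The derivatives at the end points $0$ and $\xi_0$ are one-sided.
\<close>

definition good_profile_with_interface ::
    "nat \<Rightarrow> real \<Rightarrow> real \<Rightarrow> real \<Rightarrow> real \<Rightarrow> (real \<Rightarrow> real) \<Rightarrow> bool"
where
  "good_profile_with_interface N m p \<sigma> \<alpha> f \<longleftrightarrow>
    (\<forall>\<xi>\<ge>0. f \<xi> \<ge> 0) \<and>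
    f 0 > 0 \<and> (f has_real_derivative 0) (at_right 0) \<and>
    (\<exists>\<xi>\<^sub>0>0.
      f \<xi>\<^sub>0 = 0 \<and> (\<forall>\<xi>\<in>{0<..<\<xi>\<^sub>0}. f \<xi> > 0) \<and>
      ((\<lambda>\<xi>. f \<xi> powr m) has_real_derivative 0) (at_left \<xi>\<^sub>0) \<and>
      solves_profile_eq_on N m p \<sigma> \<alpha> ((m - 1) / 2 * \<alpha>) {0<..<\<xi>\<^sub>0} f)"

end

theory Submission imports Defs begin

text \<open>
  The obstruction is local at the interface \<open>\<xi>\<^sub>0\<close>. Write \<open>g = f\<^sup>m\<close> and collect every term of the
  equation that is a derivative into the flux \<open>h = g' + (N - 1) g / \<xi> + \<beta> \<xi> f\<close>. What remains of
  the equation is \<open>h' = (\<alpha> + \<beta>) f - (N - 1) g / \<xi>\<^sup>2 - \<xi>\<^sup>\<sigma> f\<^sup>p\<close>. Where \<open>f\<close> is small, the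
  reaction wins because \<open>p < 1\<close>, so that \<open>h' \<le> - k f\<^sup>p\<close> for some \<open>k > 0\<close>, while
  \<open>g' \<le> h \<le> g' + C f\<close>.

  These inequalities determine how much reaction the flux has to absorb. The interface condition
  \<open>g'(\<xi>\<^sub>0) = 0\<close> and the monotonicity of \<open>h\<close> give \<open>h \<ge> 0\<close>, hence \<open>- g' \<le> C f\<close>: the profile cannot
  reach zero too steeply, and a profile that is not steep leaves a large amount of
  reaction \<open>\<integral> f\<^sup>p\<close> between \<open>\<xi>\<close> and \<open>\<xi>\<^sub>0\<close>, at least a multiple of \<open>f(\<xi>)\<close> to the power \<open>m + p - 1\<close>.
  All of it must be carried by \<open>h \<le> g' + C f\<close>. When \<open>m + p < 2\<close> that power of \<open>f\<close> dominates \<open>C f\<close>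
  as \<open>f \<rightarrow> 0\<close>, so \<open>g' > 0\<close> just before \<open>\<xi>\<^sub>0\<close>, which contradicts \<open>g > 0 = g(\<xi>\<^sub>0)\<close>. The lemma
  \<open>no_interface_of_flux_bounds\<close> is this argument in differential form; the theorem only has to
  supply the bounds for \<open>h\<close>.
\<close>

text \<open>
  The mean value theorem up to an end point at which only a left derivative is available; the
  interface condition enters the proof through such increments.
\<close>

lemma mvt_left_endpoint:
  fixes g g' :: "real \<Rightarrow> real"
  assumes "x < b"
    and deriv: "\<And>y. x \<le> y \<Longrightarrow> y < b \<Longrightarrow> (g has_real_derivative g' y) (at y)"
    and left: "(g has_real_derivative D) (at_left b)"
  obtains z where "x < z" "z < b" "g b - g x = (b - x) * g' z"
proof -
  have "continuous (at y within {x..b}) g" if "y \<in> {x..b}" for y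
  proof (cases "y = b")
    case True
    have "continuous (at_left b) g"
      using left by (rule has_field_derivative_imp_has_derivative[THEN has_derivative_continuous])
    then show ?thesis
      using True \<open>x < b\<close> by (simp add: at_within_Icc_at_left)
  next
    case False
    then have "isCont g y"
      using that deriv[of y] by (intro DERIV_isCont[of g "g' y"]) auto
    then show ?thesis
      by (rule continuous_at_imp_continuous_at_within)
  qed
  then have "continuous_on {x..b} g"
    by (simp add: continuous_on_eq_continuous_within)
  moreover have "g differentiable (at y)" if "x < y" "y < b" for y
    using deriv[of y] that by (auto simp: real_differentiable_def)
  ultimately obtain l z where z: "x < z" "z < b" "DERIV g z :> l" "g b - g x = (b - x) * l"
    using MVT[of x b g] \<open>x < b\<close> by auto
  have "l = g' z"
    using z deriv[of z] by (auto intro: DERIV_unique)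
  with z that show thesis by auto
qed

text \<open>
  Were \<open>h\<close> to reach a negative value \<open>- d\<close>, then \<open>g'\<close> would stay below \<open>- d\<close> up to \<open>b\<close>, and
  so would the difference quotients whose limit is the left derivative of \<open>g\<close> at \<open>b\<close>.
\<close>

lemma nonincreasing_majorant_of_derivative_nonneg:
  fixes g g' h :: "real \<Rightarrow> real"
  assumes deriv: "\<And>y. a < y \<Longrightarrow> y < b \<Longrightarrow> (g has_real_derivative g' y) (at y)"
    and left: "(g has_real_derivative 0) (at_left b)"
    and major: "\<And>y. a < y \<Longrightarrow> y < b \<Longrightarrow> g' y \<le> h y"
    and mono: "\<And>x y. a < x \<Longrightarrow> x \<le> y \<Longrightarrow> y < b \<Longrightarrow> h y \<le> h x"
    and x: "a < x" "x < b"
  shows "0 \<le> h x"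
proof (rule ccontr)
  assume "\<not> 0 \<le> h x"
  then have neg: "h x < 0" by simp
  have quotient: "(g y - g b) / (y - b) \<le> h x" if y: "x < y" "y < b" for y
  proof -
    obtain z where z: "y < z" "z < b" "g b - g y = (b - y) * g' z"
      using mvt_left_endpoint[of y b g g' 0] deriv left y x by (metis dual_order.strict_trans less_le_trans)
    have "g' z \<le> h x"
      using major[of z] mono[of x z] x y z by linarith
    moreover have "(g y - g b) / (y - b) = g' z"
      using z y by (simp add: divide_simps algebra_simps)
    ultimately show ?thesis by simp
  qed
  have "((\<lambda>y. (g y - g b) / (y - b)) \<longlongrightarrow> 0) (at_left b)"
    using left by (simp add: has_field_derivative_iff)
  moreover have "\<forall>\<^sub>F y in at_left b. (g y - g b) / (y - b) \<le> h x"
    using quotient eventually_at_left_real[OF x(2)] by (auto elim: eventually_mono)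
  ultimately have "0 \<le> h x"
    by (rule tendsto_upperbound) simp
  with neg show False by simp
qed

text \<open>
  Since \<open>h \<ge> 0\<close>, the profile decays slowly enough that \<open>- (f\<^sup>q)'\<close>, with \<open>q = m + p - 1\<close>, is
  controlled by the reaction \<open>k f\<^sup>p\<close> and hence by \<open>- h'\<close>; so \<open>h\<close> dominates a multiple of
  \<open>f\<^sup>q\<close>, and \<open>q < 1\<close> makes this larger than \<open>C f\<close> near \<open>b\<close>. This is the known nonexistence of
  finite travelling waves for \<open>u\<^sub>t = (u\<^sup>m)\<^sub>x\<^sub>x + u\<^sup>p\<close> with \<open>m + p < 2\<close>, in a form that
  tolerates lower order terms and non-monotone \<open>f\<close>.
\<close>

lemma no_interface_of_flux_bounds:
  fixes f f' h h' :: "real \<Rightarrow> real" and a b m p k C :: real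
  assumes "a < b" "0 < m" "1 < m + p" "m + p < 2" "0 < k" "0 < C"
    and pos: "\<And>x. a < x \<Longrightarrow> x < b \<Longrightarrow> 0 < f x"
    and zero: "f b = 0"
    and f': "\<And>x. a < x \<Longrightarrow> x < b \<Longrightarrow> (f has_real_derivative f' x) (at x)"
    and h': "\<And>x. a < x \<Longrightarrow> x < b \<Longrightarrow> (h has_real_derivative h' x) (at x)"
    and left: "((\<lambda>x. f x powr m) has_real_derivative 0) (at_left b)"
    and reaction: "\<And>x. a < x \<Longrightarrow> x < b \<Longrightarrow> h' x \<le> - k * f x powr p"
    and flux_ge: "\<And>x. a < x \<Longrightarrow> x < b \<Longrightarrow> m * f x powr (m - 1) * f' x \<le> h x"
    and flux_le: "\<And>x. a < x \<Longrightarrow> x < b \<Longrightarrow> h x \<le> m * f x powr (m - 1) * f' x + C * f x"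
  shows False
proof -
  define g' where "g' x = m * f x powr (m - 1) * f' x" for x
  define q where "q = m + p - 1"
  have q: "0 < q" "q < 1"
    using assms by (auto simp: q_def)
  have powr_deriv: "((\<lambda>x. f x powr r) has_real_derivative r * f x powr (r - 1) * f' x) (at x)"
    if "a < x" "x < b" for x r
    using that pos[of x] by (auto intro!: derivative_eq_intros f')
  have g': "((\<lambda>x. f x powr m) has_real_derivative g' x) (at x)" if "a < x" "x < b" for x
    using powr_deriv[OF that] by (simp add: g'_def)

  have near_b: "\<forall>\<^sub>F x in at_left b. a < x \<and> x < b"
    using eventually_at_left_real[OF \<open>a < b\<close>] by simp
  have f_lim: "(f \<longlongrightarrow> 0) (at_left b)"
  proof -
    have "continuous (at_left b) (\<lambda>x. f x powr m)"
      using left by (rule has_field_derivative_imp_has_derivative[THEN has_derivative_continuous])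
    then have "((\<lambda>x. f x powr m) \<longlongrightarrow> 0) (at_left b)"
      using zero \<open>0 < m\<close> by (simp add: continuous_within)
    then have "((\<lambda>x. (f x powr m) powr (1 / m)) \<longlongrightarrow> 0) (at_left b)"
      by (rule tendsto_zero_powrI[OF _ tendsto_const]) (use \<open>0 < m\<close> in auto)
    moreover have "\<forall>\<^sub>F x in at_left b. (f x powr m) powr (1 / m) = f x"
      using near_b
    proof eventually_elim
      case (elim x)
      then show ?case
        using \<open>0 < m\<close> pos[of x] by (simp add: powr_powr)
    qed
    ultimately show ?thesis
      by (simp cong: tendsto_cong)
  qed
  have f_powr_lim: "((\<lambda>x. f x powr r) \<longlongrightarrow> 0) (at_left b)" if "0 < r" for r
    by (rule tendsto_zero_powrI[OF f_lim tendsto_const])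
      (use that near_b in \<open>auto elim!: eventually_mono dest: pos\<close>)

  have h_mono: "h y \<le> h x" if "a < x" "x \<le> y" "y < b" for x y
  proof (rule DERIV_nonpos_imp_nonincreasing[OF \<open>x \<le> y\<close>])
    fix z assume z: "x \<le> z" "z \<le> y"
    then have "h' z \<le> 0"
      using reaction[of z] \<open>0 < k\<close> that by (smt (verit) mult_nonneg_nonneg mult_minus_left powr_ge_zero)
    then show "\<exists>D. (h has_real_derivative D) (at z) \<and> D \<le> 0"
      using h'[of z] z that by auto
  qed
  have h_nonneg: "0 \<le> h x" if "a < x" "x < b" for x
    by (rule nonincreasing_majorant_of_derivative_nonneg[where h = h, OF g' left])
      (use flux_ge h_mono that in \<open>auto simp: g'_def\<close>)

  \<comment> \<open>The constant is chosen so that the bound \<open>- g' \<le> C f\<close> makes \<open>h - c f\<^sup>q\<close> nonincreasing.\<close>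
  define c where "c = k * m / (q * C)"
  have c: "0 < c"
    using assms q by (simp add: c_def)
  have lower: "c * f x powr q \<le> h x" if x: "a < x" "x < b" for x
  proof (rule ccontr)
    assume "\<not> c * f x powr q \<le> h x"
    then have "h x - c * f x powr q < 0" (is "?G x < 0") by simp
    have G_mono: "?G y \<le> ?G x" if y: "x \<le> y" "y < b" for y
    proof (rule DERIV_nonpos_imp_nonincreasing[OF \<open>x \<le> y\<close>])
      fix z assume "x \<le> z" "z \<le> y"
      then have z: "a < z" "z < b" using x y by auto
      have fz: "0 < f z" using pos z by simp
      have "- g' z \<le> C * f z"
        using h_nonneg[OF z] flux_le[OF z] by (simp add: g'_def)
      then have "c * q / m * f z powr (p - 1) * (- g' z) \<le> c * q / m * f z powr (p - 1) * (C * f z)"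
        using c q \<open>0 < m\<close> by (intro mult_left_mono) auto
      also have "\<dots> = k * f z powr p"
        using fz q \<open>0 < m\<close> \<open>0 < C\<close> by (simp add: c_def powr_diff)
      also have "c * q / m * f z powr (p - 1) * (- g' z) = - (c * (q * f z powr (q - 1) * f' z))"
      proof -
        have "f z powr (q - 1) = f z powr (p - 1) * f z powr (m - 1)"
          by (simp add: q_def add.commute flip: powr_add)
        then show ?thesis
          using \<open>0 < m\<close> by (simp add: g'_def)
      qed
      finally have "h' z - c * (q * f z powr (q - 1) * f' z) \<le> 0"
        using reaction[OF z] by simp
      moreover have "(?G has_real_derivative h' z - c * (q * f z powr (q - 1) * f' z)) (at z)"
        by (intro DERIV_diff DERIV_cmult h' powr_deriv z)
      ultimately show "\<exists>D. (?G has_real_derivative D) (at z) \<and> D \<le> 0"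
        by blast
    qed
    have "((\<lambda>y. c * f y powr q) \<longlongrightarrow> c * 0) (at_left b)"
      by (intro tendsto_intros f_powr_lim q)
    then have "\<forall>\<^sub>F y in at_left b. c * f y powr q < - ?G x"
      using \<open>?G x < 0\<close> by (intro order_tendstoD) auto
    moreover have "\<forall>\<^sub>F y in at_left b. x < y \<and> y < b"
      using eventually_at_left_real[OF x(2)] by simp
    ultimately have "\<forall>\<^sub>F y in at_left b. x < y \<and> y < b \<and> c * f y powr q < - ?G x"
      by eventually_elim auto
    then obtain y where y: "x < y" "y < b" "c * f y powr q < - ?G x"
      using eventually_happens'[OF trivial_limit_at_left_real] by blast
    then have "h y < 0"
      using G_mono[of y] by simp
    then show False
      using h_nonneg[of y] x y by simp
  qed

  have "((\<lambda>x. C * f x powr (1 - q)) \<longlongrightarrow> C * 0) (at_left b)"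
    by (intro tendsto_intros f_powr_lim) (use q in auto)
  then have "\<forall>\<^sub>F x in at_left b. C * f x powr (1 - q) < c"
    using c by (intro order_tendstoD) auto
  then obtain d where d: "d < b" "\<And>x. d < x \<Longrightarrow> x < b \<Longrightarrow> C * f x powr (1 - q) < c"
    using eventually_at_left[OF \<open>a < b\<close>] by auto
  have g'_pos: "0 < g' x" if x: "max a d < x" "x < b" for x
  proof -
    have "C * f x powr (1 - q) * f x powr q < c * f x powr q"
      using d(2)[of x] x pos[of x] by (intro mult_strict_right_mono) auto
    moreover have "f x powr (1 - q) * f x powr q = f x"
      using pos[of x] x by (simp flip: powr_add)
    ultimately have "C * f x < c * f x powr q"
      by (simp add: mult.assoc)
    then show ?thesis
      using lower[of x] flux_le[of x] x by (simp add: g'_def)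
  qed
  obtain x where x: "max a d < x" "x < b"
    using \<open>a < b\<close> d(1) dense[of "max a d" b] by auto
  obtain z where z: "x < z" "z < b" "f b powr m - f x powr m = (b - x) * g' z"
    using mvt_left_endpoint[of x b "\<lambda>x. f x powr m" g' 0] g' left x by auto
  have "0 < (b - x) * g' z"
    using g'_pos[of z] x z by simp
  moreover have "0 < f x powr m"
    using pos[of x] x by simp
  moreover have "f b powr m = 0"
    using zero by simp
  ultimately show False
    using z(3) by linarith
qed

theorem theorem1p4:
  fixes N :: nat and m p \<sigma> :: real
  assumes "N \<ge> 1" and "m > 1" and "0 < p" and "p < 1"
    and "\<sigma> = 2 * (1 - p) / (m - 1)"
    and "m + p < 2"
  shows "\<not> (\<exists>\<alpha>>0. \<exists>f. good_profile_with_interface N m p \<sigma> \<alpha> f)"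
proof
  assume "\<exists>\<alpha>>0. \<exists>f. good_profile_with_interface N m p \<sigma> \<alpha> f"
  then obtain \<alpha> f where "\<alpha> > 0" and prof: "good_profile_with_interface N m p \<sigma> \<alpha> f"
    by blast
  define \<beta> where "\<beta> = (m - 1) / 2 * \<alpha>"
  define g where "g = (\<lambda>x. f x powr m)"
  have "0 < \<beta>"
    using \<open>\<alpha> > 0\<close> \<open>m > 1\<close> by (simp add: \<beta>_def)
  have "0 < \<sigma>"
    using assms by simp
  obtain b where "0 < b" and zero: "f b = 0" and pos: "\<And>x. 0 < x \<Longrightarrow> x < b \<Longrightarrow> 0 < f x"
    and left: "((\<lambda>x. f x powr m) has_real_derivative 0) (at_left b)"
    and sol: "solves_profile_eq_on N m p \<sigma> \<alpha> \<beta> {0<..<b} f"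
    using prof unfolding good_profile_with_interface_def \<beta>_def by auto
  have eq: "deriv (deriv g) x + (real N - 1) / x * deriv g x - \<alpha> * f x + \<beta> * x * deriv f x
      + x powr \<sigma> * f x powr p = 0"
    and df: "(f has_real_derivative deriv f x) (at x)"
    and dg: "(g has_real_derivative deriv g x) (at x)"
    and ddg: "(deriv g has_real_derivative deriv (deriv g) x) (at x)"
    if "0 < x" "x < b" for x
    using sol that unfolding solves_profile_eq_on_def Let_def g_def
    by (auto simp: DERIV_deriv_iff_real_differentiable)
  have deriv_g: "deriv g x = m * f x powr (m - 1) * deriv f x" if "0 < x" "x < b" for x
  proof -
    have "(g has_real_derivative m * f x powr (m - 1) * deriv f x) (at x)"
      unfolding g_def using that pos[of x] by (auto intro!: derivative_eq_intros df)
    then show ?thesis by (rule DERIV_imp_deriv)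
  qed

  define h where "h x = deriv g x + (real N - 1) * g x / x + \<beta> * x * f x" for x
  define h' where "h' x = (\<alpha> + \<beta>) * f x - (real N - 1) * g x / x\<^sup>2 - x powr \<sigma> * f x powr p" for x
  have dh: "(h has_real_derivative h' x) (at x)" if "0 < x" "x < b" for x
  proof -
    have "(h has_real_derivative deriv (deriv g) x
        + ((real N - 1) * deriv g x * x - (real N - 1) * g x * 1) / (x * x)
        + (\<beta> * f x + \<beta> * x * deriv f x)) (at x)"
      unfolding h_def using that
      by (auto intro!: derivative_eq_intros df dg ddg)
    moreover have "deriv (deriv g) x
        + ((real N - 1) * deriv g x * x - (real N - 1) * g x * 1) / (x * x)
        + (\<beta> * f x + \<beta> * x * deriv f x) = h' x"
    proof -
      have g'': "deriv (deriv g) x = \<alpha> * f x - (real N - 1) / x * deriv g x - \<beta> * x * deriv f x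
          - x powr \<sigma> * f x powr p"
        using eq[OF that] by simp
      show ?thesis
        unfolding h'_def g'' using that by (simp add: field_simps power2_eq_square)
    qed
    ultimately show ?thesis by simp
  qed

  \<comment> \<open>Half of the reaction, with its weight bounded below on \<open>(b/2, b)\<close>, is given up to absorb
    the terms linear in \<open>f\<close>.\<close>
  define k where "k = (b / 2) powr \<sigma> / 2"
  define C where "C = (real N - 1) / (b / 2) + \<beta> * b"
  have "0 < k" using \<open>0 < b\<close> by (simp add: k_def)
  have "0 < C" using \<open>0 < b\<close> \<open>0 < \<beta>\<close> \<open>N \<ge> 1\<close> by (auto simp: C_def intro!: add_nonneg_pos)

  \<comment> \<open>Below \<open>\<delta>\<close> both \<open>g \<le> f\<close> and \<open>(\<alpha> + \<beta>) f \<le> k f\<^sup>p\<close> hold.\<close>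
  define \<delta> where "\<delta> = min 1 ((k / (\<alpha> + \<beta>)) powr (1 / (1 - p)))"
  have "0 < \<delta>" using \<open>0 < k\<close> \<open>0 < \<alpha>\<close> \<open>0 < \<beta>\<close> by (simp add: \<delta>_def)
  have "continuous (at_left b) g"
    using left unfolding g_def
    by (rule has_field_derivative_imp_has_derivative[THEN has_derivative_continuous])
  then have "(g \<longlongrightarrow> 0) (at_left b)"
    using zero \<open>m > 1\<close> by (simp add: continuous_within g_def)
  then have "\<forall>\<^sub>F x in at_left b. g x < \<delta> powr m"
    using \<open>0 < \<delta>\<close> by (intro order_tendstoD) auto
  then obtain d where d: "d < b" "\<And>x. d < x \<Longrightarrow> x < b \<Longrightarrow> g x < \<delta> powr m"
    using eventually_at_left[OF \<open>0 < b\<close>] by auto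
  define a where "a = max (b / 2) d"
  have a: "a < b" "b / 2 \<le> a" "0 < a" using d \<open>0 < b\<close> by (auto simp: a_def)
  have small: "f x < \<delta>" if "a < x" "x < b" for x
  proof (rule ccontr)
    assume "\<not> f x < \<delta>"
    then have "\<delta> powr m \<le> f x powr m"
      using \<open>0 < \<delta>\<close> \<open>m > 1\<close> by (intro powr_mono2) auto
    then show False
      using d(2)[of x] that by (simp add: g_def a_def)
  qed

  show False
  proof (rule no_interface_of_flux_bounds[where a = a and b = b and f = f and f' = "deriv f"
        and h = h and h' = h' and m = m and p = p and k = k and C = C])
    fix x assume x: "a < x" "x < b"
    have x0: "0 < x" "b / 2 < x" using x a by auto
    have fx: "0 < f x" "f x < \<delta>" using pos small x x0 by auto
    have gx: "0 \<le> g x" "g x \<le> f x"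
    proof -
      have "f x powr m \<le> f x powr 1"
        using fx \<open>m > 1\<close> by (intro powr_mono') (auto simp: \<delta>_def)
      then show "0 \<le> g x" "g x \<le> f x" using fx by (auto simp: g_def)
    qed
    show "0 < f x" by fact
    show "(f has_real_derivative deriv f x) (at x)"
      and "(h has_real_derivative h' x) (at x)"
      using df dh x x0 by auto
    show "m * f x powr (m - 1) * deriv f x \<le> h x"
      using deriv_g[of x] x x0 gx fx \<open>0 < \<beta>\<close> \<open>N \<ge> 1\<close> by (simp add: h_def)
    have "(real N - 1) * g x / x \<le> (real N - 1) * f x / (b / 2)"
      using gx x0 \<open>N \<ge> 1\<close> \<open>0 < b\<close> by (intro frac_le mult_left_mono mult_nonneg_nonneg) auto
    moreover have "\<beta> * x * f x \<le> \<beta> * b * f x"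
      using fx x \<open>0 < \<beta>\<close> by (intro mult_right_mono mult_left_mono) auto
    ultimately show "h x \<le> m * f x powr (m - 1) * deriv f x + C * f x"
      using deriv_g[of x] x x0 by (simp add: h_def C_def algebra_simps)
    have "f x powr (1 - p) \<le> ((k / (\<alpha> + \<beta>)) powr (1 / (1 - p))) powr (1 - p)"
      using fx \<open>p < 1\<close> by (intro powr_mono2) (auto simp: \<delta>_def)
    also have "\<dots> = k / (\<alpha> + \<beta>)"
      using \<open>p < 1\<close> \<open>0 < k\<close> \<open>0 < \<alpha>\<close> \<open>0 < \<beta>\<close> by (simp add: powr_powr)
    finally have "(\<alpha> + \<beta>) * f x powr (1 - p) * f x powr p \<le> k * f x powr p"
      using \<open>0 < \<alpha>\<close> \<open>0 < \<beta>\<close> by (intro mult_right_mono) (auto simp: field_simps)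
    moreover have "f x powr (1 - p) * f x powr p = f x"
      using fx by (simp flip: powr_add)
    ultimately have "(\<alpha> + \<beta>) * f x \<le> k * f x powr p"
      by (simp add: mult.assoc)
    moreover have "2 * k * f x powr p \<le> x powr \<sigma> * f x powr p"
      using x0 \<open>0 < b\<close> \<open>0 < \<sigma>\<close> by (auto simp: k_def intro!: mult_right_mono powr_mono2)
    moreover have "0 \<le> (real N - 1) * g x / x\<^sup>2"
      using gx \<open>N \<ge> 1\<close> by simp
    ultimately show "h' x \<le> - k * f x powr p"
      unfolding h'_def by simp
  qed (use assms a zero left \<open>0 < k\<close> \<open>0 < C\<close> in auto)
qed

end
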